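(* The zeros of all polynomials $Q_n^{(2)}(z)$, $n\geq 2$, lie on the two segments of the unit circle that satisfy $|\mathrm{Im}(z)|>\frac{1}{3}$.
   Context: Let $Z=(w,x,y,z)$ be a quadruple of real or complex variables. The polynomials $S(n;Z)$, $n\ge 0$, are defined by the generating function $$\sum_{n=0}^{\infty}S(n;Z)q^n = \prod_{j=0}^{\infty}\left(1+wq^{3^j}\right)\left(1+xq^{3^j}\right)\left(1+yq^{3^j}+zq^{2\cdot 3^j}\right).$$ Define $Q_n(Z):=S(\tfrac{3^n-3}{2};Z)$ for $n\geq 1$, and let $Q_n^{(2)}(z):=Q_n(Z_2)$ with $Z_2:=(z,z,z,z^2)$, a polynomial in the single variable $z$.
   Formalization: The formal theorem concerns the nonzero zeros only: z = 0 is a zero of every Q_n^{(2)} with n ≥ 2 (for example Q_2^{(2)}(z) = 3z + 3z^3) and does not lie on the unit circle. *)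

theory Defs
  imports "HOL-Analysis.Analysis"
begin

text \<open>The factor of index \<open>j\<close> of the generating function. Coefficients are taken in an arbitrary
  integral domain, so that a quadruple \<open>(w, x, y, z)\<close> may consist of real or complex numbers,
  but also of polynomials.\<close>

definition S_factor :: "'a::idom \<times> 'a \<times> 'a \<times> 'a \<Rightarrow> nat \<Rightarrow> 'a fps" where
  "S_factor Z j = (case Z of (w, x, y, z) \<Rightarrow>
     (1 + fps_const w * fps_X ^ (3 ^ j)) *
     (1 + fps_const x * fps_X ^ (3 ^ j)) *
     (1 + fps_const y * fps_X ^ (3 ^ j) + fps_const z * fps_X ^ (2 * 3 ^ j)))"

text \<open>The infinite product is taken in the \<open>X\<close>-adic topology of formal power series.\<close>

definition S :: "nat \<Rightarrow> 'a::idom \<times> 'a \<times> 'a \<times> 'a \<Rightarrow> 'a" where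
  "S n Z = fps_nth (\<Prod>j. S_factor Z j) n"

text \<open>For \<open>n \<ge> 1\<close> the truncated subtraction and the division are both exact.\<close>

definition Q :: "nat \<Rightarrow> 'a::idom \<times> 'a \<times> 'a \<times> 'a \<Rightarrow> 'a" where
  "Q n Z = S ((3 ^ n - 3) div 2) Z"

text \<open>The indeterminate \<open>z\<close> is \<open>monom 1 1\<close>. Note that \<open>0\<close> is a zero of \<open>Q2 n\<close>, of multiplicity \<open>n - 1\<close>,
  for every \<open>n \<ge> 2\<close>; for instance, \<open>Q2 2 = 3 z + 3 z\<^sup>3\<close>. Statements about the zeros of \<open>Q2 n\<close> on the
  unit circle therefore concern its nonzero zeros.\<close>

definition Z2 :: "complex poly \<times> complex poly \<times> complex poly \<times> complex poly" where
  "Z2 = (monom 1 1, monom 1 1, monom 1 1, monom 1 2)"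

definition Q2 :: "nat \<Rightarrow> complex poly" where
  "Q2 n = Q n Z2"

text \<open>The infinite product converges, so \<open>prodinf\<close> is not a junk value.\<close>

lemma S_factor_nth_0 [simp]: "fps_nth (S_factor Z j) 0 = 1"
  by (cases Z) (simp add: S_factor_def)

lemma S_factor_nth_small:
  assumes "0 < k" "k < 3 ^ j"
  shows "fps_nth (S_factor Z j) k = 0"
proof -
  obtain w x y z where Z: "Z = (w, x, y, z)" by (cases Z)
  define m :: nat where "m = 3 ^ j"
  define g where "g = fps_const w + (1 + fps_const w * fps_X ^ m) * fps_const x
     + (1 + fps_const w * fps_X ^ m) * (1 + fps_const x * fps_X ^ m)
       * (fps_const y + fps_const z * fps_X ^ m)"
  have "S_factor Z j = 1 + fps_X ^ m * g"
    unfolding S_factor_def Z g_def m_def[symmetric] mult_2 power_add prod.case by algebra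
  with assms show ?thesis
    by (simp add: m_def[symmetric] fps_X_power_mult_nth)
qed

lemma has_prod_S_factor: "S_factor Z has_prod (\<Prod>j. S_factor Z j)"
proof -
  define P where "P n = (\<Prod>j\<le>n. S_factor Z j)" for n
  have P_Suc: "fps_nth (P (Suc n)) k = fps_nth (P n) k" if "k < 3 ^ Suc n" for n k
  proof -
    have "fps_nth (P (Suc n)) k
        = (\<Sum>i=0..k. fps_nth (P n) i * fps_nth (S_factor Z (Suc n)) (k - i))"
      by (simp add: P_def fps_mult_nth)
    also have "\<dots> = (\<Sum>i=0..k. if i = k then fps_nth (P n) i else 0)"
      using that by (intro sum.cong) (auto simp: S_factor_nth_small simp del: power_Suc)
    finally show ?thesis by simp
  qed
  have stable: "fps_nth (P n) k = fps_nth (P k) k" if "n \<ge> k" for n k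
    using that
  proof (induction n rule: dec_induct)
    case (step n)
    have "Suc n < 3 ^ Suc n"
      by (rule less_exp[THEN less_le_trans]) (rule power_mono, auto)
    with step(1) have "k < 3 ^ Suc n" by linarith
    then show ?case
      using P_Suc step.IH by simp
  qed simp
  have "P \<longlonglongrightarrow> Abs_fps (\<lambda>k. fps_nth (P k) k)"
    by (rule tendsto_fpsI) (auto simp: eventually_sequentially intro!: exI stable)
  moreover have "Abs_fps (\<lambda>k. fps_nth (P k) k) \<noteq> 0"
  proof
    assume "Abs_fps (\<lambda>k. fps_nth (P k) k) = 0"
    then have "fps_nth (Abs_fps (\<lambda>k. fps_nth (P k) k)) 0 = 0" by simp
    then show False by (simp add: P_def)
  qed
  ultimately have "S_factor Z has_prod Abs_fps (\<lambda>k. fps_nth (P k) k)"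
    unfolding has_prod_def raw_has_prod_def P_def by simp
  then show ?thesis
    using has_prod_unique by metis
qed

end

theory Submission
  imports Defs "HOL-Computational_Algebra.Formal_Laurent_Series"
begin

text \<open>
  The generating product \<open>F(q)\<close> satisfies \<open>F(q) = P(q) F(q\<^sup>3)\<close>, where \<open>P\<close> is its factor of index 0, a
  polynomial \<open>1 + c\<^sub>1 q + c\<^sub>2 q\<^sup>2 + c\<^sub>3 q\<^sup>3 + c\<^sub>4 q\<^sup>4\<close>. Comparing coefficients expresses
  \<open>S(3m + 3)\<close> and \<open>S(3m + 4)\<close> linearly by \<open>S(m)\<close> and \<open>S(m + 1)\<close>. The indices
  \<open>N\<^sub>n = (3\<^sup>n - 3)/2\<close> satisfy \<open>N\<^sub>n\<^sub>+\<^sub>1 = 3 N\<^sub>n + 3\<close>, so the pair \<open>(S(N\<^sub>n), S(N\<^sub>n + 1))\<close> evolves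
  under a fixed two-by-two matrix, and by Cayley-Hamilton \<open>Q\<^sub>n\<close> obeys a linear recurrence of order two
  (lemma \<open>Q_recurrence\<close>). For \<open>Z\<^sub>2\<close> the matrix has trace \<open>3z + 3z\<^sup>3\<close> and determinant \<open>8z\<^sup>4\<close>.

  If \<open>\<lambda>\<close> and \<open>\<mu>\<close> are its eigenvalues, then \<open>Q\<^sub>n\<close> is the complete homogeneous sum
  \<open>\<lambda>\<^sup>n\<^sup>-\<^sup>1 + \<lambda>\<^sup>n\<^sup>-\<^sup>2\<mu> + \<dots> + \<mu>\<^sup>n\<^sup>-\<^sup>1\<close>, that is, a rescaled Chebyshev polynomial of the second kind. At a
  zero \<open>z \<noteq> 0\<close> the eigenvalues are therefore distinct and of equal modulus (lemma
  \<open>distinct_eigenvalues_of_equal_norm\<close>). Dividing them by the square root \<open>2\<surd>2 z\<^sup>2\<close> of the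
  determinant gives two distinct numbers of modulus one with product one, \<open>\<zeta>\<close> and its conjugate, and
  the trace becomes \<open>3(z + 1/z) = 4\<surd>2 Re \<zeta>\<close> with \<open>\<bar>Re \<zeta>\<bar> < 1\<close>. Hence \<open>z + 1/z\<close> is real of modulus
  less than \<open>4\<surd>2/3 < 2\<close>. This forces \<open>z\<close> onto the unit circle, where \<open>z + 1/z = 2 Re z\<close>, and so
  \<open>(Im z)\<^sup>2 = 1 - (Re z)\<^sup>2 > 1 - 8/9 = 1/9\<close>.
\<close>

section \<open>The functional equation of the generating product\<close>

lemma S_factor_Suc: "S_factor Z (Suc j) = S_factor Z j oo fps_X ^ 3"
proof -
  have "fps_X ^ k oo fps_X ^ 3 = (fps_X ^ (3 * k) :: 'a fps)" for k
    by (subst fps_compose_power[symmetric]) (simp_all add: power_mult)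
  then show ?thesis
    by (cases Z) (simp add: S_factor_def fps_compose_mult_distrib fps_compose_add_distrib
        mult.left_commute)
qed

lemma prodinf_S_factor_functional_equation:
  "(\<Prod>j. S_factor Z j) = S_factor Z 0 * ((\<Prod>j. S_factor Z j) oo fps_X ^ 3)" (is "?F = _")
proof -
  define P where "P n = (\<Prod>j\<le>n. S_factor Z j)" for n
  have lim: "P \<longlonglongrightarrow> ?F"
    unfolding P_def by (rule has_prod_imp_tendsto) (rule has_prod_S_factor)
  have "P (Suc n) = S_factor Z 0 * (P n oo fps_X ^ 3)" for n
    unfolding P_def prod.atMost_Suc_shift
    by (simp add: fps_compose_prod_distrib S_factor_Suc)
  moreover have "(\<lambda>n. S_factor Z 0 * (P n oo fps_X ^ 3)) \<longlonglongrightarrow> S_factor Z 0 * (?F oo fps_X ^ 3)"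
  proof (rule tendsto_fpsI)
    fix k
    \<comment> \<open>The \<open>k\<close>-th coefficient of the product depends on the first \<open>k + 1\<close> coefficients of
      the partial product only, and these finitely many become stationary simultaneously.\<close>
    have "\<forall>\<^sub>F n in sequentially. \<forall>i\<in>{..k}. fps_nth (P n) i = fps_nth ?F i"
      using lim by (simp add: tendsto_fps_iff eventually_ball_finite_distrib)
    then show "\<forall>\<^sub>F n in sequentially. fps_nth (S_factor Z 0 * (P n oo fps_X ^ 3)) k
        = fps_nth (S_factor Z 0 * (?F oo fps_X ^ 3)) k"
    proof eventually_elim
      case (elim n)
      have "i div 3 \<le> k" if "i \<le> k" for i
        using that by simp
      with elim show ?case
        unfolding fps_mult_nth fps_nth_compose_X_power by (intro sum.cong) auto
    qed
  qed
  ultimately have "(\<lambda>n. P (Suc n)) \<longlonglongrightarrow> S_factor Z 0 * (?F oo fps_X ^ 3)"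
    by simp
  then show ?thesis
    using LIMSEQ_Suc[OF lim] LIMSEQ_unique by blast
qed

lemma S_0: "S 0 Z = 1"
proof -
  have "(\<lambda>n. \<Prod>j\<le>n. S_factor Z j) \<longlonglongrightarrow> (\<Prod>j. S_factor Z j)"
    by (rule has_prod_imp_tendsto) (rule has_prod_S_factor)
  then have "\<forall>\<^sub>F n in sequentially. fps_nth (\<Prod>j\<le>n. S_factor Z j) 0 = S 0 Z"
    by (simp add: tendsto_fps_iff S_def)
  moreover have "fps_nth (\<Prod>j\<le>n. S_factor Z j) 0 = 1" for n
    by (induction n) simp_all
  ultimately show ?thesis
    by simp
qed

text \<open>A coefficient of \<open>P(q) F(q\<^sup>3)\<close> combines five consecutive coefficients of \<open>F(q\<^sup>3)\<close>, of
  which at most two have an index divisible by three; the others vanish.\<close>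

lemma S_recurrences:
  fixes w x y z :: "'a::idom"
  defines "Z \<equiv> (w, x, y, z)"
  shows "S 1 Z = w + x + y"
    and "S (3 * m + 3) Z = S (m + 1) Z + (w * x * y + (w + x) * z) * S m Z"
    and "S (3 * m + 4) Z = (w + x + y) * S (m + 1) Z + w * x * z * S m Z"
proof -
  define G where "G = (\<Prod>j. S_factor Z j) oo fps_X ^ 3"
  have G: "fps_nth G n = (if 3 dvd n then S (n div 3) Z else 0)" for n
    by (simp add: G_def fps_nth_compose_X_power S_def)
  have expand: "(1 + a * t) * (1 + b * t) * (1 + c * t + d * t ^ 2)
      = 1 + (a + b + c) * t ^ 1 + (a * b + (a + b) * c + d) * t ^ 2
        + (a * b * c + (a + b) * d) * t ^ 3 + a * b * d * t ^ 4" for a b c d t :: "'a fps"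
    by (simp add: eval_nat_numeral algebra_simps)
  have "S_factor Z 0 = 1 + fps_const (w + x + y) * fps_X ^ 1
      + fps_const (w * x + (w + x) * y + z) * fps_X ^ 2
      + fps_const (w * x * y + (w + x) * z) * fps_X ^ 3 + fps_const (w * x * z) * fps_X ^ 4"
    unfolding S_factor_def Z_def prod.case power_0 mult_1_right power_one_right
      fps_const_add[symmetric] fps_const_mult[symmetric] expand ..
  then have F: "(\<Prod>j. S_factor Z j) = G + fps_const (w + x + y) * (fps_X ^ 1 * G)
      + fps_const (w * x + (w + x) * y + z) * (fps_X ^ 2 * G)
      + fps_const (w * x * y + (w + x) * z) * (fps_X ^ 3 * G)
      + fps_const (w * x * z) * (fps_X ^ 4 * G)"
    using prodinf_S_factor_functional_equation[of Z, folded G_def]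
    by (simp only: distrib_right mult_1_left mult.assoc)
  have S: "S n Z = fps_nth G n + (w + x + y) * (if n < 1 then 0 else fps_nth G (n - 1))
      + (w * x + (w + x) * y + z) * (if n < 2 then 0 else fps_nth G (n - 2))
      + (w * x * y + (w + x) * z) * (if n < 3 then 0 else fps_nth G (n - 3))
      + w * x * z * (if n < 4 then 0 else fps_nth G (n - 4))" for n
    unfolding S_def F fps_add_nth fps_mult_left_const_nth fps_X_power_mult_nth ..
  show "S 1 Z = w + x + y"
    unfolding S[of 1] G by (simp add: S_0)
  have nd: "\<not> 3 dvd 3 * m + 1" "\<not> 3 dvd 3 * m + 2" "\<not> 3 dvd 3 * m + 4"
    by presburger+
  have div3: "(3 * m + 3) div 3 = m + 1"
    by simp
  have sub3: "3 * m + 3 - 1 = 3 * m + 2" "3 * m + 3 - 2 = 3 * m + 1" "3 * m + 3 - 3 = 3 * m"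
    "3 * m + 3 < 4 \<longleftrightarrow> m = 0" "\<not> 3 * m + 3 < 3" "\<not> 3 * m + 3 < 2" "\<not> 3 * m + 3 < 1"
    by auto
  have nd': "\<not> 3 dvd 3 * m + 3 - 4" if "m \<noteq> 0"
    using that by presburger
  show "S (3 * m + 3) Z = S (m + 1) Z + (w * x * y + (w + x) * z) * S m Z"
    using nd nd' unfolding S[of "3 * m + 3"] sub3 G div3 by simp
  have sub4: "3 * m + 4 - 1 = 3 * m + 3" "3 * m + 4 - 2 = 3 * m + 2" "3 * m + 4 - 3 = 3 * m + 1"
    "3 * m + 4 - 4 = 3 * m" "\<not> 3 * m + 4 < 4" "\<not> 3 * m + 4 < 3" "\<not> 3 * m + 4 < 2"
    "\<not> 3 * m + 4 < 1"
    by auto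
  show "S (3 * m + 4) Z = (w + x + y) * S (m + 1) Z + w * x * z * S m Z"
    using nd unfolding S[of "3 * m + 4"] sub4 G div3 by simp
qed

section \<open>The second-order recurrence along the subsequence\<close>

lemma Q_Suc_Suc_index: "(3 ^ Suc (Suc n) - 3) div 2 = 3 * ((3 ^ Suc n - 3) div 2) + (3::nat)"
proof -
  obtain k where k: "(3::nat) ^ Suc n = 2 * k + 1"
    by (rule oddE[of "3 ^ Suc n :: nat"]) simp_all
  moreover have "(3::nat) ^ Suc n \<ge> 3"
    by simp
  ultimately have "(3::nat) ^ Suc n = 2 * (k - 1) + 3"
    by linarith
  then show ?thesis
    by simp
qed

text \<open>The pair \<open>(S(N\<^sub>n), S(N\<^sub>n + 1))\<close> is multiplied by the matrix with rows \<open>(c\<^sub>3, 1)\<close> and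
  \<open>(c\<^sub>4, c\<^sub>1)\<close>; eliminating its second component leaves a recurrence whose coefficients are the
  trace and the negative determinant.\<close>

lemma Q_recurrence:
  fixes w x y z :: "'a::idom"
  defines "Z \<equiv> (w, x, y, z)"
    and "c1 \<equiv> w + x + y" and "c3 \<equiv> w * x * y + (w + x) * z" and "c4 \<equiv> w * x * z"
  shows "Q 1 Z = 1"
    and "Q 2 Z = c1 + c3"
    and "Q (Suc (Suc (Suc n))) Z
      = (c1 + c3) * Q (Suc (Suc n)) Z - (c1 * c3 - c4) * Q (Suc n) Z"
proof -
  note rec = S_recurrences[where w = w and x = x and y = y and z = z,
      folded Z_def c1_def c3_def c4_def]
  define B where "B k = S ((3 ^ k - 3) div 2 + 1) Z" for k
  show "Q 1 Z = 1"
    by (simp add: Q_def S_0)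
  show "Q 2 Z = c1 + c3"
    using rec(1) rec(2)[of 0] by (simp add: Q_def S_0)
  have A_Suc: "Q (Suc (Suc k)) Z = B (Suc k) + c3 * Q (Suc k) Z" for k
    unfolding Q_def B_def Q_Suc_Suc_index by (rule rec(2))
  have B_Suc: "B (Suc (Suc k)) = c1 * B (Suc k) + c4 * Q (Suc k) Z" for k
    using rec(3)[of "(3 ^ Suc k - 3) div 2"]
    unfolding Q_def B_def Q_Suc_Suc_index by (simp add: numeral_eq_Suc)
  have B: "B (Suc n) = Q (Suc (Suc n)) Z - c3 * Q (Suc n) Z"
    by (simp add: A_Suc)
  show "Q (Suc (Suc (Suc n))) Z
      = (c1 + c3) * Q (Suc (Suc n)) Z - (c1 * c3 - c4) * Q (Suc n) Z"
    unfolding A_Suc[of "Suc n"] B_Suc B by (simp add: algebra_simps)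
qed

lemma poly_Q2_recurrence:
  shows "poly (Q2 1) z = 1"
    and "poly (Q2 2) z = 3 * z + 3 * z ^ 3"
    and "poly (Q2 (Suc (Suc (Suc n)))) z
      = (3 * z + 3 * z ^ 3) * poly (Q2 (Suc (Suc n))) z - 8 * z ^ 4 * poly (Q2 (Suc n)) z"
proof -
  show "poly (Q2 1) z = 1"
    unfolding Q2_def Z2_def Q_recurrence(1) by simp
  show "poly (Q2 2) z = 3 * z + 3 * z ^ 3"
    unfolding Q2_def Z2_def Q_recurrence(2) poly_add poly_mult poly_monom by algebra
  show "poly (Q2 (Suc (Suc (Suc n)))) z
      = (3 * z + 3 * z ^ 3) * poly (Q2 (Suc (Suc n))) z - 8 * z ^ 4 * poly (Q2 (Suc n)) z"
    unfolding Q2_def Z2_def Q_recurrence(3) poly_add poly_diff poly_mult poly_monom by algebra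
qed

section \<open>Zeros in terms of the eigenvalues\<close>

text \<open>Solving the recurrence gives \<open>(a - b) u\<^sub>n = a\<^sup>n\<^sup>+\<^sup>1 - b\<^sup>n\<^sup>+\<^sup>1\<close>, so a zero of \<open>u\<close> makes
  these two powers equal. In the degenerate case \<open>a = b\<close> this says nothing, but then
  \<open>u\<^sub>n = (n + 1) a\<^sup>n\<close>, which does not vanish.\<close>

lemma distinct_eigenvalues_of_equal_norm:
  fixes u :: "nat \<Rightarrow> 'a::real_normed_field"
  assumes "u 0 = 1" and "u 1 = a + b"
    and rec: "\<And>n. u (Suc (Suc n)) = (a + b) * u (Suc n) - a * b * u n"
    and zero: "u n = 0" and "a \<noteq> 0"
  shows "a \<noteq> b \<and> norm a = norm b"
proof
  show "a \<noteq> b"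
  proof
    assume "a = b"
    have "u k = of_nat (Suc k) * a ^ k \<and> u (Suc k) = of_nat (Suc (Suc k)) * a ^ Suc k" for k
    proof (induction k)
      case 0
      then show ?case using assms(1,2) \<open>a = b\<close> by simp
    next
      case (Suc k)
      then show ?case using rec[of k] \<open>a = b\<close> by (simp add: algebra_simps)
    qed
    then have "of_nat (Suc n) * a ^ n = 0"
      using zero by metis
    then show False
      using \<open>a \<noteq> 0\<close> by (simp del: of_nat_Suc)
  qed
  have "(a - b) * u k = a ^ Suc k - b ^ Suc k
      \<and> (a - b) * u (Suc k) = a ^ Suc (Suc k) - b ^ Suc (Suc k)" for k
  proof (induction k)
    case 0
    then show ?case using assms(1,2) by (simp add: algebra_simps)
  next
    case (Suc k)
    have "(a - b) * u (Suc (Suc k)) = (a + b) * ((a - b) * u (Suc k)) - a * b * ((a - b) * u k)"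
      unfolding rec by (simp add: algebra_simps)
    also have "\<dots> = a ^ Suc (Suc (Suc k)) - b ^ Suc (Suc (Suc k))"
      unfolding Suc.IH[THEN conjunct1] Suc.IH[THEN conjunct2] by (simp add: algebra_simps)
    finally show ?case
      using Suc.IH by blast
  qed
  then have "a ^ Suc n = b ^ Suc n"
    using zero by (metis mult_zero_right right_minus_eq)
  then have "norm a ^ Suc n = norm b ^ Suc n"
    by (metis norm_power)
  then show "norm a = norm b"
    by (metis power_inject_base norm_ge_zero)
qed

lemma exists_sum_product_complex:
  obtains a b :: complex where "a + b = s" and "a * b = p"
proof
  let ?d = "csqrt (s\<^sup>2 - 4 * p)"
  show "(s + ?d) / 2 + (s - ?d) / 2 = s"
    by (simp add: field_simps)
  have "?d * ?d = s\<^sup>2 - 4 * p"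
    by (simp flip: power2_eq_square)
  then show "(s + ?d) / 2 * ((s - ?d) / 2) = p"
    by (simp add: algebra_simps power2_eq_square)
qed

text \<open>The map \<open>z \<mapsto> z + 1/z\<close> takes real values only on the real line and on the unit circle, and on
  the real line its values have modulus at least 2.\<close>

lemma add_inverse_real_less_2_imp_unit_circle:
  assumes "z \<noteq> 0" and eq: "z + inverse z = of_real r" and "\<bar>r\<bar> < 2"
  shows "cmod z = 1 \<and> r = 2 * Re z"
proof -
  have quad: "z\<^sup>2 + 1 = of_real r * z"
    using eq \<open>z \<noteq> 0\<close> by (simp add: field_simps power2_eq_square)
  have re: "(Re z)\<^sup>2 - (Im z)\<^sup>2 + 1 = r * Re z" and im: "2 * Re z * Im z = r * Im z"
    using arg_cong[OF quad, of Re] arg_cong[OF quad, of Im] by (simp_all add: power2_eq_square)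
  have "Im z \<noteq> 0"
  proof
    assume "Im z = 0"
    then have "(Re z)\<^sup>2 + 1 = r * Re z"
      using re by simp
    then have "(2 * Re z - r)\<^sup>2 = r\<^sup>2 - 4"
      by (simp add: power2_eq_square algebra_simps)
    moreover have "r\<^sup>2 < 2\<^sup>2"
      using \<open>\<bar>r\<bar> < 2\<close> by (metis abs_ge_zero power2_abs power_strict_mono zero_less_numeral)
    ultimately show False
      using zero_le_power2[of "2 * Re z - r"] by simp
  qed
  with im have r: "r = 2 * Re z"
    by simp
  with re have "(Re z)\<^sup>2 + (Im z)\<^sup>2 = 1"
    by (simp add: power2_eq_square)
  then show ?thesis
    using r by (simp add: cmod_def)
qed

theorem proposition5p3:
  fixes n :: nat and z :: complex
  assumes "n \<ge> 2"
    and "poly (Q2 n) z = 0"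
    and "z \<noteq> 0"
  shows "cmod z = 1 \<and> \<bar>Im z\<bar> > 1 / 3"
proof -
  define u where "u k = poly (Q2 (Suc k)) z" for k
  obtain a b where ab: "a + b = 3 * z + 3 * z ^ 3" "a * b = 8 * z ^ 4"
    by (rule exists_sum_product_complex)
  have "a \<noteq> 0"
    using ab(2) \<open>z \<noteq> 0\<close> by auto
  have "u 0 = 1" "u 1 = a + b"
    using poly_Q2_recurrence(1,2)[of z] by (simp_all add: u_def ab numeral_2_eq_2)
  moreover have "u (Suc (Suc k)) = (a + b) * u (Suc k) - a * b * u k" for k
    unfolding u_def ab by (rule poly_Q2_recurrence)
  moreover have "u (n - 1) = 0"
    using assms(1,2) by (simp add: u_def)
  ultimately have "a \<noteq> b" "cmod a = cmod b"
    using distinct_eigenvalues_of_equal_norm \<open>a \<noteq> 0\<close> by blast+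
  \<comment> \<open>Scaling by a square root of the determinant normalises the product of the eigenvalues to 1.\<close>
  define s where "s = of_real (sqrt 8) * z\<^sup>2"
  have s: "s * s = a * b" "s \<noteq> 0"
    using \<open>z \<noteq> 0\<close> by (simp_all add: s_def ab eval_nat_numeral algebra_simps flip: of_real_mult)
  define \<zeta> where "\<zeta> = a / s"
  have "cmod s * cmod s = cmod a * cmod a"
    using arg_cong[OF s(1), of cmod] \<open>cmod a = cmod b\<close> by (simp add: norm_mult)
  then have norm_\<zeta>: "cmod \<zeta> = 1"
    using \<open>a \<noteq> 0\<close> \<open>s \<noteq> 0\<close> by (simp add: \<zeta>_def norm_divide flip: power2_eq_square)
  have "\<zeta> * (b / s) = 1"
    using s(2) by (simp add: \<zeta>_def times_divide_times_eq flip: s(1))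
  moreover have "\<zeta> * cnj \<zeta> = 1"
    using complex_norm_square[of \<zeta>] norm_\<zeta> by simp
  ultimately have b: "b / s = cnj \<zeta>"
    by (metis mult_cancel_left mult_zero_left zero_neq_one)
  have "\<zeta> \<noteq> cnj \<zeta>"
    using \<open>a \<noteq> b\<close> \<open>s \<noteq> 0\<close> b by (metis \<zeta>_def divide_cancel_right)
  then have "Im \<zeta> \<noteq> 0"
    by (auto simp: complex_eq_iff)
  moreover have "(Re \<zeta>)\<^sup>2 + (Im \<zeta>)\<^sup>2 = 1"
    using norm_\<zeta> by (simp add: cmod_def)
  ultimately have "(Re \<zeta>)\<^sup>2 < 1"
    using zero_less_power2[of "Im \<zeta>"] by linarith
  define r where "r = 2 * sqrt 8 / 3 * Re \<zeta>"
  have r2: "r\<^sup>2 < 32 / 9"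
    using \<open>(Re \<zeta>)\<^sup>2 < 1\<close> by (simp add: r_def power_mult_distrib power_divide)
  have "3 * z + 3 * z ^ 3 = s * (\<zeta> + cnj \<zeta>)"
    unfolding b[symmetric] ab(1)[symmetric] using \<open>s \<noteq> 0\<close> by (simp add: \<zeta>_def field_simps)
  also have "\<dots> = 3 * z\<^sup>2 * of_real r"
    by (simp add: s_def r_def complex_add_cnj)
  finally have "(3 * z) * (1 + z\<^sup>2) = (3 * z) * (z * of_real r)"
    by (simp add: algebra_simps eval_nat_numeral)
  then have "1 + z\<^sup>2 = z * of_real r"
    using \<open>z \<noteq> 0\<close> by simp
  then have "z + inverse z = of_real r"
    using \<open>z \<noteq> 0\<close> by (simp add: field_simps power2_eq_square)
  moreover have "\<bar>r\<bar> < 2"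
    by (rule power2_less_imp_less) (use r2 in simp_all)
  ultimately have z: "cmod z = 1" "r = 2 * Re z"
    using add_inverse_real_less_2_imp_unit_circle \<open>z \<noteq> 0\<close> by blast+
  have "(Re z)\<^sup>2 + (Im z)\<^sup>2 = 1"
    using z(1) by (simp add: cmod_def)
  with r2 z(2) have "(1 / 3)\<^sup>2 < \<bar>Im z\<bar>\<^sup>2"
    by (simp add: power_mult_distrib power_divide)
  then have "1 / 3 < \<bar>Im z\<bar>"
    by (rule power2_less_imp_less) simp
  with z(1) show ?thesis
    by blast
qed

end
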